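(* Let $(\mathcal{A},\varphi,\varphi')$ be an infinitesimal probability space and let $x_1,x_2\in\mathcal{A}$ be infinitesimally free, with $x_2$ an infinitesimal operator. Let $q=i(x_1x_2-x_2x_1)$ and $\omega=\sqrt{\kappa_2(x_1)}$. Then for all $n\ge1$ $$\kappa'_n(q)=m'_n(q)=\kappa'_n(\omega x_2)+\kappa'_n(-\omega x_2)=\begin{cases}2\kappa'_n(\omega x_2)& n\text{ even},\\ 0 & n\text{ odd}.\end{cases}$$ Moreover, $g_q=g_{\omega x_2}+g_{-\omega x_2}$ and $r_q=r_{\omega x_2}+r_{-\omega x_2}$ (as formal power series).
   Context: An infinitesimal probability space $(\mathcal{A},\varphi,\varphi')$ is a unital algebra $\mathcal{A}$ over $\mathbb{C}$ with linear functionals $\varphi,\varphi':\mathcal{A}\to\mathbb{C}$ such that $\varphi(1)=1$ and $\varphi'(1)=0$. For $a\in\mathcal{A}$: $m_n(a)=\varphi(a^n)$, $m_n'(a)=\varphi'(a^n)$. An element $a$ is an infinitesimal operator if $\varphi(a^n)=0$ for all $n\geq 1$. Unital subalgebras $(\mathcal{A}_i)_{i\in I}$ are infinitesimally free if, whenever $a_k\in\mathcal{A}_{i_k}$ with $i_1\ne i_2\ne\cdots\ne i_n$ (consecutive indices distinct) and $\varphi(a_k)=0$ for all $k$, one has $\varphi(a_1\cdots a_n)=0$ and $\varphi'(a_1\cdots a_n)=\sum_{k=1}^n\varphi'(a_k)\varphi(a_1\cdots a_{k-1}a_{k+1}\cdots a_n)$. Elements $x_1,x_2$ are infinitesimally free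 if the unital algebras they generate are. Let $NC(n)$ be the non-crossing partitions of $[n]=\{1,\dots,n\}$. For multilinear functionals $f_n:\mathcal{A}^n\to\mathbb{C}$ and $\pi\in NC(n)$, $f_\pi(a_1,\dots,a_n)=\prod_{V\in\pi}f_{|V|}((a_1,\dots,a_n)|_V)$, where $(a_1,\dots,a_n)|_V=(a_{i_1},\dots,a_{i_s})$ for $V=\{i_1<\cdots<i_s\}$; given also $f'_n:\mathcal{A}^n\to\mathbb{C}$, $\partial f_\pi=\sum_{V\in\pi}\partial f_{\pi,V}$, where $\partial f_{\pi,V}$ is $f_\pi$ with the factor $f_{|V|}$ of the block $V$ replaced by $f'_{|V|}$. The free cumulants $\kappa_n$ and infinitesimal free cumulants $\kappa_n'$ are defined inductively by $\varphi(a_1\cdots a_n)=\sum_{\pi\in NC(n)}\kappa_\pi(a_1,\dots,a_n)$ and $\varphi'(a_1\cdots a_n)=\sum_{\pi\in NC(n)}\partial\kappa_\pi(a_1,\dots,a_n)$. Write $\kappa_n(a)=\kappa_n(a,\dots,a)$, $\kappa'_n(a)=\kappa_n'(a,\dots,a)$; in particular $\kappa_2(x_1)=\varphi(x_1^2)-\varphi(x_1)^2$. The infinitesimal Cauchy transform and infinitesimal $r$-transform of $a$ are the formal series $g_a(z)=\sum_{n\ge1}m_n'(a)z^{-(n+1)}$ and $r_a(z)=\sum_{n\ge0}\kappa'_{n+1}(a)z^n$. Here $\sqrt{\kappa_2(x_1)}$ is a fixed square root. *)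

theory Defs
  imports
    "HOL-Library.Disjoint_Sets"
    "HOL-Computational_Algebra.Formal_Power_Series"
    Complex_Main
begin

section \<open>Infinitesimal probability spaces\<close>

text \<open>
  The class \<open>ring_1\<close> provides an associative, not necessarily commutative, unital ring
  with \<open>0 \<noteq> 1\<close>; the last condition is no restriction here, as \<open>\<phi> 1 = 1\<close>.
\<close>

locale complex_algebra = vector_space scale
  for scale :: "complex \<Rightarrow> 'a::ring_1 \<Rightarrow> 'a" +
  assumes scale_mult_left: "scale c x * y = scale c (x * y)"
    and scale_mult_right: "x * scale c y = scale c (x * y)"

locale infinitesimal_probability_space =
  complex_algebra scale +
  phi: Vector_Spaces.linear scale "(*)" \<phi> +
  phi': Vector_Spaces.linear scale "(*)" \<phi>'
  for scale :: "complex \<Rightarrow> 'a::ring_1 \<Rightarrow> 'a"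
    and \<phi> \<phi>' :: "'a \<Rightarrow> complex" +
  assumes phi_one: "\<phi> 1 = 1"
    and phi'_one: "\<phi>' 1 = 0"

definition infinitesimal_operator :: "('a::monoid_mult \<Rightarrow> complex) \<Rightarrow> 'a \<Rightarrow> bool" where
  "infinitesimal_operator \<phi> a \<longleftrightarrow> (\<forall>n\<ge>1. \<phi> (a ^ n) = 0)"


section \<open>Infinitesimal freeness\<close>

definition unital_subalgebra :: "(complex \<Rightarrow> 'a::ring_1 \<Rightarrow> 'a) \<Rightarrow> 'a set \<Rightarrow> bool" where
  "unital_subalgebra scale B \<longleftrightarrow>
     1 \<in> B \<and> (\<forall>x\<in>B. \<forall>y\<in>B. x + y \<in> B) \<and> (\<forall>x\<in>B. \<forall>y\<in>B. x * y \<in> B) \<and>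
     (\<forall>c. \<forall>x\<in>B. scale c x \<in> B)"

text \<open>
  The words \<open>a\<^sub>1, \<dots>, a\<^sub>n\<close> and their indices \<open>i\<^sub>1, \<dots>, i\<^sub>n\<close> are lists (indexed from 0);
  \<open>distinct_adj\<close> says that consecutive indices are distinct.  Nonempty words only, since
  \<open>\<phi>\<close> of the empty product is 1.
\<close>

definition infinitesimally_free ::
  "(complex \<Rightarrow> 'a::ring_1 \<Rightarrow> 'a) \<Rightarrow> ('a \<Rightarrow> complex) \<Rightarrow> ('a \<Rightarrow> complex) \<Rightarrow>
   'i set \<Rightarrow> ('i \<Rightarrow> 'a set) \<Rightarrow> bool" where
  "infinitesimally_free scale \<phi> \<phi>' I A \<longleftrightarrow>
     (\<forall>i\<in>I. unital_subalgebra scale (A i)) \<and>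
     (\<forall>is as. as \<noteq> [] \<longrightarrow> length is = length as \<longrightarrow> set is \<subseteq> I \<longrightarrow> distinct_adj is \<longrightarrow>
        (\<forall>k<length as. as ! k \<in> A (is ! k) \<and> \<phi> (as ! k) = 0) \<longrightarrow>
        \<phi> (prod_list as) = 0 \<and>
        \<phi>' (prod_list as) =
          (\<Sum>k<length as. \<phi>' (as ! k) * \<phi> (prod_list (take k as @ drop (Suc k) as))))"

definition infinitesimally_free_pair ::
  "(complex \<Rightarrow> 'a::ring_1 \<Rightarrow> 'a) \<Rightarrow> ('a \<Rightarrow> complex) \<Rightarrow> ('a \<Rightarrow> complex) \<Rightarrow>
   'a \<Rightarrow> 'a \<Rightarrow> bool" where
  "infinitesimally_free_pair scale \<phi> \<phi>' x\<^sub>1 x\<^sub>2 \<longleftrightarrow>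
     infinitesimally_free scale \<phi> \<phi>' {1, 2::nat}
       (\<lambda>i. unital_subalgebra scale hull {if i = 1 then x\<^sub>1 else x\<^sub>2})"


section \<open>Non-crossing partitions and cumulants\<close>

text \<open>
  The ground set is \<open>{..<n} = {0, \<dots>, n - 1}\<close> instead of \<open>{1, \<dots>, n}\<close>, so that the
  restriction of a word \<open>as\<close> to a block \<open>V\<close> is \<open>nths as V\<close>.
\<close>

definition NC :: "nat \<Rightarrow> nat set set set" where
  "NC n = {\<pi>. partition_on {..<n} \<pi> \<and>
     \<not> (\<exists>V\<in>\<pi>. \<exists>W\<in>\<pi>. V \<noteq> W \<and>
          (\<exists>a b c d. a < b \<and> b < c \<and> c < d \<and> a \<in> V \<and> c \<in> V \<and> b \<in> W \<and> d \<in> W))}"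

text \<open>
  A sequence of functionals of \<open>n\<close> arguments, one for each \<open>n\<close>, is a single function on
  lists.  The next two definitions are \<open>f\<^sub>\<pi>\<close> and \<open>\<partial>f\<^sub>\<pi>\<close>; in the latter,
  \<open>f'\<close> replaces \<open>f\<close> on the block \<open>V\<close>.
\<close>

definition partition_ext :: "('a list \<Rightarrow> complex) \<Rightarrow> nat set set \<Rightarrow> 'a list \<Rightarrow> complex" where
  "partition_ext f \<pi> as = (\<Prod>V\<in>\<pi>. f (nths as V))"

definition partition_deriv ::
  "('a list \<Rightarrow> complex) \<Rightarrow> ('a list \<Rightarrow> complex) \<Rightarrow> nat set set \<Rightarrow> 'a list \<Rightarrow> complex" where
  "partition_deriv f f' \<pi> as = (\<Sum>V\<in>\<pi>. f' (nths as V) * (\<Prod>W\<in>\<pi> - {V}. f (nths as W)))"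

lemma partition_ext_cong [fundef_cong]:
  assumes "\<pi> = \<pi>'" "as = as'" "\<And>bs. bs \<in> nths as' ` \<pi>' \<Longrightarrow> f bs = g bs"
  shows "partition_ext f \<pi> as = partition_ext g \<pi>' as'"
  using assms by (auto simp: partition_ext_def intro!: prod.cong)

lemma partition_deriv_cong [fundef_cong]:
  assumes "\<pi> = \<pi>'" "as = as'" "f = g" "\<And>bs. bs \<in> nths as' ` \<pi>' \<Longrightarrow> f' bs = g' bs"
  shows "partition_deriv f f' \<pi> as = partition_deriv g g' \<pi>' as'"
  using assms by (auto simp: partition_deriv_def intro!: sum.cong)

lemma length_nths_NC:
  assumes "\<pi> \<in> NC (length as)" "\<pi> \<noteq> {{..<length as}}" "V \<in> \<pi>"
  shows "length (nths as V) < length as"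
proof -
  let ?n = "length as"
  have p: "partition_on {..<?n} \<pi>" using assms(1) by (simp add: NC_def)
  have V: "V \<subseteq> {..<?n}" using p assms(3) by (auto simp: partition_on_def)
  have "V \<noteq> {..<?n}"
  proof
    assume eq: "V = {..<?n}"
    have "W = V" if "W \<in> \<pi>" for W
    proof (rule ccontr)
      assume "W \<noteq> V"
      then have "W \<inter> V = {}" using p that assms(3) by (auto simp: partition_on_def disjoint_def)
      moreover have "W \<subseteq> V" "W \<noteq> {}" using p that eq by (auto simp: partition_on_def)
      ultimately show False by auto
    qed
    with assms(2,3) eq show False by auto
  qed
  with V have "card V < ?n" using psubset_card_mono[of "{..<?n}" V] by auto
  moreover have "{i. i < ?n \<and> i \<in> V} = V" using V by auto
  ultimately show ?thesis by (simp add: length_nths)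
qed

text \<open>
  The moment-cumulant formulas, solved for the term of the partition with the single block
  \<open>{..<n}\<close>.  The formulas themselves are \<open>moment_cumulant\<close> and
  \<open>inf_moment_cumulant\<close> below.  The value at the empty list is never used.
\<close>

function free_cumulant :: "('a::monoid_mult \<Rightarrow> complex) \<Rightarrow> 'a list \<Rightarrow> complex" where
  "free_cumulant \<phi> as = \<phi> (prod_list as) -
     (\<Sum>\<pi>\<in>NC (length as) - {{{..<length as}}}. partition_ext (\<lambda>bs. free_cumulant \<phi> bs) \<pi> as)"
  by pat_completeness auto
termination
  by (relation "measure (\<lambda>(\<phi>, as). length as)") (auto intro: length_nths_NC)

function inf_free_cumulant ::
  "('a::monoid_mult \<Rightarrow> complex) \<Rightarrow> ('a \<Rightarrow> complex) \<Rightarrow> 'a list \<Rightarrow> complex" where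
  "inf_free_cumulant \<phi> \<phi>' as = \<phi>' (prod_list as) -
     (\<Sum>\<pi>\<in>NC (length as) - {{{..<length as}}}.
        partition_deriv (free_cumulant \<phi>) (\<lambda>bs. inf_free_cumulant \<phi> \<phi>' bs) \<pi> as)"
  by pat_completeness auto
termination
  by (relation "measure (\<lambda>(\<phi>, \<phi>', as). length as)") (auto intro: length_nths_NC)

declare free_cumulant.simps [simp del] inf_free_cumulant.simps [simp del]

lemma finite_NC: "finite (NC n)"
proof (rule finite_subset)
  show "NC n \<subseteq> Pow (Pow {..<n})" by (auto simp: NC_def partition_on_def)
qed simp

lemma one_block_in_NC: "n > 0 \<Longrightarrow> {{..<n}} \<in> NC n"
  by (auto simp: NC_def partition_on_def disjoint_def)

lemma moment_cumulant:
  assumes "as \<noteq> []"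
  shows "\<phi> (prod_list as) = (\<Sum>\<pi>\<in>NC (length as). partition_ext (free_cumulant \<phi>) \<pi> as)"
proof -
  have "partition_ext (free_cumulant \<phi>) {{..<length as}} as = free_cumulant \<phi> as"
    by (simp add: partition_ext_def nths_upt_eq_take)
  then show ?thesis
    using sum.remove[OF finite_NC one_block_in_NC, of "length as"
        "\<lambda>\<pi>. partition_ext (free_cumulant \<phi>) \<pi> as"] assms
    by (simp add: free_cumulant.simps[of \<phi> as])
qed

lemma inf_moment_cumulant:
  assumes "as \<noteq> []"
  shows "\<phi>' (prod_list as) =
    (\<Sum>\<pi>\<in>NC (length as). partition_deriv (free_cumulant \<phi>) (inf_free_cumulant \<phi> \<phi>') \<pi> as)"
proof -
  have "partition_deriv (free_cumulant \<phi>) (inf_free_cumulant \<phi> \<phi>') {{..<length as}} as =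
      inf_free_cumulant \<phi> \<phi>' as"
    by (simp add: partition_deriv_def nths_upt_eq_take)
  then show ?thesis
    using sum.remove[OF finite_NC one_block_in_NC, of "length as"
        "\<lambda>\<pi>. partition_deriv (free_cumulant \<phi>) (inf_free_cumulant \<phi> \<phi>') \<pi> as"] assms
    by (simp add: inf_free_cumulant.simps[of \<phi> \<phi>' as])
qed


section \<open>Moments, cumulants and transforms of a single element\<close>

definition inf_moment :: "('a::monoid_mult \<Rightarrow> complex) \<Rightarrow> nat \<Rightarrow> 'a \<Rightarrow> complex" where
  "inf_moment \<phi>' n a = \<phi>' (a ^ n)"

definition cumulant :: "('a::monoid_mult \<Rightarrow> complex) \<Rightarrow> nat \<Rightarrow> 'a \<Rightarrow> complex" where
  "cumulant \<phi> n a = free_cumulant \<phi> (replicate n a)"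

definition inf_cumulant ::
  "('a::monoid_mult \<Rightarrow> complex) \<Rightarrow> ('a \<Rightarrow> complex) \<Rightarrow> nat \<Rightarrow> 'a \<Rightarrow> complex" where
  "inf_cumulant \<phi> \<phi>' n a = inf_free_cumulant \<phi> \<phi>' (replicate n a)"

text \<open>
  The Cauchy transform is a formal series in \<open>1/z\<close>: the formal variable \<open>fps_X\<close> stands
  for \<open>z\<^sup>-\<^sup>1\<close>, so the coefficient of \<open>fps_X ^ (n + 1)\<close> is the \<open>n\<close>-th
  infinitesimal moment for \<open>n \<ge> 1\<close>.  In the \<open>r\<close>-transform \<open>fps_X\<close> stands
  for \<open>z\<close>.
\<close>

definition inf_Cauchy_transform :: "('a::monoid_mult \<Rightarrow> complex) \<Rightarrow> 'a \<Rightarrow> complex fps" where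
  "inf_Cauchy_transform \<phi>' a = Abs_fps (\<lambda>k. if k \<ge> 2 then inf_moment \<phi>' (k - 1) a else 0)"

definition inf_r_transform ::
  "('a::monoid_mult \<Rightarrow> complex) \<Rightarrow> ('a \<Rightarrow> complex) \<Rightarrow> 'a \<Rightarrow> complex fps" where
  "inf_r_transform \<phi> \<phi>' a = Abs_fps (\<lambda>n. inf_cumulant \<phi> \<phi>' (n + 1) a)"

end

theory Submission
  imports Defs
begin

text \<open>
  For an infinitesimal operator all free cumulants vanish, so in the infinitesimal
  moment-cumulant formula only the partition with one block survives and infinitesimal
  cumulants and infinitesimal moments coincide
  (\<open>inf_cumulant_infinitesimal_operator\<close>).  The theorem therefore reduces to two
  statements about moments: \<open>\<phi> (q\<^sup>n) = 0\<close>, and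
  \<open>\<phi>' (q\<^sup>n) = (\<omega>\<^sup>n + (- \<omega>)\<^sup>n) \<phi>' (x\<^sub>2\<^sup>n)\<close>.

  The commutator does not change when \<open>x\<^sub>1\<close> is replaced by the centred element
  \<open>a = x\<^sub>1 - \<phi> x\<^sub>1\<close>; write \<open>b = x\<^sub>2\<close> and
  \<open>p = ab - ba\<close>.  On the algebra generated by \<open>b\<close> the functional \<open>\<phi>\<close>
  is multiplicative, so its centred elements are closed under products.  Hence, when a product
  of letters from the two algebras is rewritten as a combination of alternating centred words,
  letters from the algebra of \<open>b\<close> can merge but not turn into scalars.  Freeness then
  shows that \<open>\<phi>\<close> vanishes on centred words with at least one such letter; and
  \<open>\<phi>'\<close> vanishes on alternating centred words with at least two, because in every
  term of the Leibniz sum at least one of them is left.  The consequence that drives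
  everything is \<open>phi'_reduce\<close>: inside \<open>\<phi>'\<close>, and after a factor from the
  algebra of \<open>x\<^sub>1\<close>, the product
  \<open>b\<^sup>k x b\<close> may be replaced by \<open>\<phi> x\<close> times \<open>b\<^sup>k\<^sup>+\<^sup>1\<close>.

  Among the words in the expansion of \<open>p\<^sup>n\<close>, only the two in which \<open>ab\<close> and
  \<open>ba\<close> alternate survive, since \<open>ab ab\<close> and \<open>ba ba\<close> contain
  \<open>b a b\<close>, which is replaced by 0.  Each factor \<open>b a a b\<close> contributes
  \<open>\<phi> (a a) = \<kappa>\<^sub>2 x\<^sub>1 = \<omega>\<^sup>2\<close>, and so does the pair of end letters
  of \<open>a b \<dots> b a\<close>.  For odd \<open>n\<close> both words have a single \<open>a\<close> at one
  end only, and they contribute 0.  The induction in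
  \<open>phi'_commutator_even_power\<close> performs this count by removing two
  factors \<open>p\<close> at a time.
\<close>

section \<open>Cumulants of infinitesimal operators\<close>

lemma nths_replicate: "nths (replicate n a) V = replicate (card {i. i < n \<and> i \<in> V}) a"
proof -
  have "set (nths (replicate n a) V) \<subseteq> {a}"
    using set_nths_subset[of "replicate n a" V] by auto
  then have "nths (replicate n a) V = replicate (length (nths (replicate n a) V)) a"
    by (intro replicate_eqI) auto
  then show ?thesis by (simp add: length_nths)
qed

lemma
  assumes "partition_on {..<n} \<pi>" "V \<in> \<pi>"
  shows nths_replicate_block: "nths (replicate n a) V = replicate (card V) a"
    and card_block_pos: "card V > 0"
proof -
  have V: "V \<subseteq> {..<n}" "V \<noteq> {}" using assms by (auto simp: partition_on_def)
  then have "{i. i < n \<and> i \<in> V} = V" by auto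
  then show "nths (replicate n a) V = replicate (card V) a" by (simp add: nths_replicate)
  show "card V > 0" using V finite_subset[OF V(1)] by (simp add: card_gt_0_iff)
qed

lemma prod_list_replicate_power: "prod_list (replicate n a) = (a::'a::monoid_mult) ^ n"
  by (induction n) auto

text \<open>
  By induction: a partition with more than one block has a block shorter than the whole word,
  whose cumulant already vanishes.
\<close>

lemma free_cumulant_infinitesimal_operator:
  assumes "infinitesimal_operator \<phi> a" "n \<ge> 1"
  shows "free_cumulant \<phi> (replicate n a) = 0"
  using assms(2)
proof (induction n rule: less_induct)
  case (less n)
  have "partition_ext (free_cumulant \<phi>) \<pi> (replicate n a) = 0"
    if \<pi>: "\<pi> \<in> NC n - {{{..<n}}}" for \<pi>
  proof -
    have p: "partition_on {..<n} \<pi>" using \<pi> by (simp add: NC_def)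
    then have "\<Union> \<pi> = {..<n}" by (simp add: partition_on_def)
    with less.prems have "0 \<in> \<Union> \<pi>" by simp
    then obtain V where V: "V \<in> \<pi>" by blast
    have "length (nths (replicate n a) V) < length (replicate n a)"
      using \<pi> V by (intro length_nths_NC[of \<pi>]) auto
    then have "free_cumulant \<phi> (nths (replicate n a) V) = 0"
      using less.IH[of "card V"] nths_replicate_block[OF p V, of a] card_block_pos[OF p V] by simp
    moreover have "finite \<pi>" using p finite_elements by blast
    ultimately show ?thesis using V by (auto simp: partition_ext_def)
  qed
  then have "(\<Sum>\<pi>\<in>NC n - {{{..<n}}}. partition_ext (free_cumulant \<phi>) \<pi> (replicate n a)) = 0"
    by (intro sum.neutral) auto
  then show ?case using assms(1) less.prems
    by (subst free_cumulant.simps)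
      (simp add: prod_list_replicate_power infinitesimal_operator_def)
qed

text \<open>
  Every term of \<open>\<partial>\<kappa>\<^sub>\<pi>\<close> keeps the ordinary cumulants of all blocks but one, so it
  vanishes unless \<open>\<pi>\<close> has a single block.
\<close>

lemma inf_cumulant_infinitesimal_operator:
  assumes "infinitesimal_operator \<phi> a" "n \<ge> 1"
  shows "inf_cumulant \<phi> \<phi>' n a = inf_moment \<phi>' n a"
proof -
  have "partition_deriv (free_cumulant \<phi>) (inf_free_cumulant \<phi> \<phi>') \<pi> (replicate n a) = 0"
    if \<pi>: "\<pi> \<in> NC n - {{{..<n}}}" for \<pi>
  proof -
    have p: "partition_on {..<n} \<pi>" using \<pi> by (simp add: NC_def)
    have fin: "finite \<pi>" using p finite_elements by blast
    have "(\<Prod>W\<in>\<pi> - {V}. free_cumulant \<phi> (nths (replicate n a) W)) = 0" if V: "V \<in> \<pi>" for V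
    proof -
      have "\<pi> \<noteq> {V}" using p \<pi> by (auto simp: partition_on_def)
      then obtain W where W: "W \<in> \<pi> - {V}" using V by blast
      then have "free_cumulant \<phi> (nths (replicate n a) W) = 0"
        using nths_replicate_block[OF p, of W a] card_block_pos[OF p, of W]
          free_cumulant_infinitesimal_operator[OF assms(1), of "card W"] by simp
      then show ?thesis using W fin by (intro prod_zero) auto
    qed
    then show ?thesis by (simp add: partition_deriv_def)
  qed
  then have "(\<Sum>\<pi>\<in>NC n - {{{..<n}}}.
      partition_deriv (free_cumulant \<phi>) (inf_free_cumulant \<phi> \<phi>') \<pi> (replicate n a)) = 0"
    by (intro sum.neutral) auto
  then show ?thesis
    by (simp add: inf_cumulant_def inf_moment_def inf_free_cumulant.simps[of _ _ "replicate n a"]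
        prod_list_replicate_power)
qed

lemma partition_on_one: "partition_on {..<1::nat} \<pi> \<Longrightarrow> \<pi> = {{..<1}}"
proof -
  assume p: "partition_on {..<1::nat} \<pi>"
  have "X = {0}" if "X \<in> \<pi>" for X
  proof -
    have "X \<subseteq> {..<1}" "X \<noteq> {}" using p that by (auto simp: partition_on_def)
    then show ?thesis by auto
  qed
  moreover have "\<pi> \<noteq> {}" using p by (auto simp: partition_on_def)
  ultimately show "\<pi> = {{..<1}}" by (auto simp: lessThan_Suc)
qed

lemma cumulant_1: "cumulant \<phi> 1 a = \<phi> a"
proof -
  have "NC 1 \<subseteq> {{{..<1}}}" using partition_on_one by (simp add: NC_def subset_iff)
  then have "NC 1 = {{{..<1}}}" using one_block_in_NC[OF zero_less_one] by blast
  then show ?thesis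
    by (simp add: cumulant_def free_cumulant.simps[of _ "[a]"])
qed

lemma partition_on_two:
  assumes "partition_on {..<2::nat} \<pi>" "\<pi> \<noteq> {{..<2}}"
  shows "\<pi> = {{0}, {1}}"
proof -
  have two: "{..<2::nat} = {0, 1}" by auto
  have union: "\<Union> \<pi> = {0, 1}" and nonempty: "{} \<notin> \<pi>"
    using assms(1) unfolding two partition_on_def by simp_all
  obtain V where V: "V \<in> \<pi>" "0 \<in> V" using union by blast
  obtain W where W: "W \<in> \<pi>" "1 \<in> W" using union by blast
  have sub: "X \<subseteq> {0, 1}" "X \<noteq> {}" if "X \<in> \<pi>" for X
    using union nonempty that by blast+
  have disj: "X = Y" if "X \<in> \<pi>" "Y \<in> \<pi>" "X \<inter> Y \<noteq> {}" for X Y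
    using assms(1) that unfolding partition_on_def disjoint_def by blast
  have all: "X = V \<or> X = W" if "X \<in> \<pi>" for X
  proof -
    have "0 \<in> X \<or> 1 \<in> X" using sub[OF that] by auto
    then show ?thesis using disj that V W by blast
  qed
  have "V \<noteq> W"
  proof
    assume "V = W"
    then have "V = {..<2}" using sub[OF V(1)] V W two by auto
    moreover have "\<pi> = {V}" using all \<open>V = W\<close> V by auto
    ultimately show False using assms(2) by simp
  qed
  then have "1 \<notin> V" "0 \<notin> W" using disj[of V W] V W by blast+
  then have "V = {0}" "W = {1}" using sub[OF V(1)] sub[OF W(1)] V W by auto
  then show ?thesis using all V W by auto
qed

lemma cumulant_2: "cumulant \<phi> 2 a = \<phi> (a * a) - (\<phi> a)\<^sup>2"
proof -
  have "NC 2 - {{{..<2}}} = {{{0}, {1}}}"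
  proof (intro equalityI subsetI)
    fix \<pi> assume "\<pi> \<in> NC 2 - {{{..<2}}}"
    then show "\<pi> \<in> {{{0}, {1}}}" using partition_on_two[of \<pi>] by (simp add: NC_def)
  next
    fix \<pi> :: "nat set set" assume "\<pi> \<in> {{{0}, {1}}}"
    then show "\<pi> \<in> NC 2 - {{{..<2}}}"
      by (auto simp: NC_def partition_on_def disjoint_def)
  qed
  moreover have "{0::nat} \<noteq> {1}" by simp
  ultimately have "cumulant \<phi> 2 a = \<phi> (a * a) - free_cumulant \<phi> [a] * free_cumulant \<phi> [a]"
    using free_cumulant.simps[of \<phi> "[a, a]"]
    by (simp add: cumulant_def partition_ext_def numeral_2_eq_2 nths_Cons)
  then show ?thesis using cumulant_1[of \<phi> a] by (simp add: cumulant_def power2_eq_square)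
qed

lemma (in complex_algebra) scale_power: "scale c x ^ n = scale (c ^ n) (x ^ n)"
  by (induction n) (simp_all add: scale_mult_left scale_mult_right)

section \<open>The algebra generated by an infinitesimal operator\<close>

lemma (in complex_algebra) hull_singleton_subset_span_powers:
  "unital_subalgebra scale hull {x} \<subseteq> span (range (\<lambda>k. x ^ k))"
proof (rule hull_minimal)
  have m: "u * v \<in> span (range (\<lambda>k. x ^ k))"
    if u: "u \<in> span (range (\<lambda>k. x ^ k))" and v: "v \<in> span (range (\<lambda>k. x ^ k))" for u v
    using u
  proof (induction rule: span_induct_alt)
    case base then show ?case by (simp add: span_zero)
  next
    case (step c u' u)
    then obtain k where k: "u' = x ^ k" by auto
    have "x ^ k * v \<in> span (range (\<lambda>k. x ^ k))" using v
    proof (induction rule: span_induct_alt)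
      case base then show ?case by (simp add: span_zero)
    next
      case (step d v' v)
      then obtain l where "v' = x ^ l" by auto
      then have "x ^ k * (scale d v' + v) = scale d (x ^ (k + l)) + x ^ k * v"
        by (simp add: distrib_left scale_mult_right power_add)
      then show ?case using step by (auto simp del: scale_right_distrib intro!: span_add span_scale span_base[OF rangeI])
    qed
    then show ?case using step k
      by (auto simp: distrib_right scale_mult_left intro!: span_add span_scale)
  qed
  have "x ^ 0 \<in> span (range (\<lambda>k. x ^ k))" by (rule span_base) blast
  then show "unital_subalgebra scale (span (range (\<lambda>k. x ^ k)))"
    using m by (auto simp: unital_subalgebra_def intro!: span_add span_scale)
  have "x ^ 1 \<in> span (range (\<lambda>k. x ^ k))" by (rule span_base) blast
  then show "{x} \<subseteq> span (range (\<lambda>k. x ^ k))" by simp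
qed

context infinitesimal_probability_space
begin

text \<open>
  On the span of the powers of \<open>x\<close>, the functional \<open>\<phi>\<close> is evaluation of
  polynomials at 0.
\<close>

lemma multiplicative_on_infinitesimal_operator:
  assumes inf: "infinitesimal_operator \<phi> x"
    and y: "y \<in> unital_subalgebra scale hull {x}" and z: "z \<in> unital_subalgebra scale hull {x}"
  shows "\<phi> (y * z) = \<phi> y * \<phi> z"
proof -
  have pow: "\<phi> (x ^ k) = (if k = 0 then 1 else 0)" for k
    using inf by (auto simp: infinitesimal_operator_def phi_one)
  have y': "y \<in> span (range (\<lambda>k. x ^ k))" and z': "z \<in> span (range (\<lambda>k. x ^ k))"
    using y z hull_singleton_subset_span_powers by auto
  have *: "\<phi> (x ^ k * z) = \<phi> (x ^ k) * \<phi> z" for k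
    using z'
  proof (induction rule: span_induct_alt)
    case base then show ?case by (simp add: phi.zero)
  next
    case (step d v' v)
    then obtain l where l: "v' = x ^ l" by auto
    then have "x ^ k * (scale d v' + v) = scale d (x ^ (k + l)) + x ^ k * v"
      by (simp add: distrib_left scale_mult_right power_add)
    then have "\<phi> (x ^ k * (scale d v' + v)) = d * \<phi> (x ^ (k + l)) + \<phi> (x ^ k) * \<phi> v"
      using step(2) by (simp only: phi.add phi.scale)
    then show ?case by (simp add: l phi.add phi.scale pow)
  qed
  show ?thesis using y'
  proof (induction rule: span_induct_alt)
    case base then show ?case by (simp add: phi.zero)
  next
    case (step d u' u)
    then have "\<phi> (u' * z) = \<phi> u' * \<phi> z" using * by auto
    then show ?case using step(2)
      by (simp add: distrib_right scale_mult_left phi.add phi.scale)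
  qed
qed

end

section \<open>Centred words in two infinitesimally free subalgebras\<close>

text \<open>
  Multiplicativity of \<open>\<phi>\<close> on the second algebra is what the algebra generated by an
  infinitesimal operator contributes to the argument.
\<close>

locale free_from_character = infinitesimal_probability_space scale \<phi> \<phi>'
  for scale :: "complex \<Rightarrow> 'a::ring_1 \<Rightarrow> 'a" and \<phi> \<phi>' :: "'a \<Rightarrow> complex" +
  fixes A :: "nat \<Rightarrow> 'a set"
  assumes free: "infinitesimally_free scale \<phi> \<phi>' {1, 2} A"
    and character: "y \<in> A 2 \<Longrightarrow> z \<in> A 2 \<Longrightarrow> \<phi> (y * z) = \<phi> y * \<phi> z"
begin

definition centred :: "(nat \<times> 'a) list \<Rightarrow> bool" where
  "centred ws \<longleftrightarrow> (\<forall>(i, x)\<in>set ws. i \<in> {1, 2} \<and> x \<in> A i \<and> \<phi> x = 0)"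

definition reduced :: "(nat \<times> 'a) list \<Rightarrow> bool" where
  "reduced ws \<longleftrightarrow> centred ws \<and> distinct_adj (map fst ws)"

text \<open>
  The condition \<open>P\<close> refers to the indices of a word only; it is used to count the
  letters with index 2 and to prescribe the first index.
\<close>

definition word_span :: "(nat list \<Rightarrow> bool) \<Rightarrow> 'a set" where
  "word_span P = span {prod_list (map snd ws) | ws. reduced ws \<and> P (map fst ws)}"

definition depth_span :: "nat \<Rightarrow> 'a set" where
  "depth_span m = word_span (\<lambda>is. m \<le> count_list is 2)"

lemma one_mem: "i \<in> {1, 2} \<Longrightarrow> 1 \<in> A i"
  and add_mem: "i \<in> {1, 2} \<Longrightarrow> x \<in> A i \<Longrightarrow> y \<in> A i \<Longrightarrow> x + y \<in> A i"
  and mult_mem: "i \<in> {1, 2} \<Longrightarrow> x \<in> A i \<Longrightarrow> y \<in> A i \<Longrightarrow> x * y \<in> A i"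
  and scale_mem: "i \<in> {1, 2} \<Longrightarrow> x \<in> A i \<Longrightarrow> scale c x \<in> A i"
  using free by (auto simp: infinitesimally_free_def unital_subalgebra_def)

lemma centre_mem:
  assumes "i \<in> {1, 2}" "x \<in> A i"
  shows "x - scale (\<phi> x) 1 \<in> A i"
  using add_mem[OF assms scale_mem[OF assms(1) one_mem[OF assms(1)]], of "- \<phi> x"]
  by (simp add: scale_minus_left)

lemma phi_centre: "\<phi> (x - scale (\<phi> x) 1) = 0"
  by (simp add: phi.diff phi.scale phi_one)

lemma power_mem: "i \<in> {1, 2} \<Longrightarrow> x \<in> A i \<Longrightarrow> x ^ k \<in> A i"
  by (induction k) (use one_mem mult_mem in auto)

lemma phi_power:
  assumes "b \<in> A 2" "\<phi> b = 0" "k \<ge> 1"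
  shows "\<phi> (b ^ k) = 0"
  using assms character[OF assms(1) power_mem[of 2 b "k - 1"]]
  by (cases k) auto

lemma word_span_mono: "(\<And>is. P is \<Longrightarrow> Q is) \<Longrightarrow> word_span P \<subseteq> word_span Q"
  unfolding word_span_def by (rule span_mono) blast

lemma word_span_base: "reduced ws \<Longrightarrow> P (map fst ws) \<Longrightarrow> prod_list (map snd ws) \<in> word_span P"
  unfolding word_span_def by (rule span_base) blast

lemma word_span_add: "v \<in> word_span P \<Longrightarrow> w \<in> word_span P \<Longrightarrow> v + w \<in> word_span P"
  and word_span_diff: "v \<in> word_span P \<Longrightarrow> w \<in> word_span P \<Longrightarrow> v - w \<in> word_span P"
  and word_span_scale: "v \<in> word_span P \<Longrightarrow> scale c v \<in> word_span P"
  and word_span_zero: "0 \<in> word_span P"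
  unfolding word_span_def by (simp_all add: span_add span_diff span_scale span_zero)

lemma left_mult_word_span:
  assumes w: "w \<in> word_span P"
    and words: "\<And>ws. reduced ws \<Longrightarrow> P (map fst ws) \<Longrightarrow> x * prod_list (map snd ws) \<in> word_span Q"
  shows "x * w \<in> word_span Q"
  using w unfolding word_span_def[of P]
proof (induction rule: span_induct_alt)
  case base then show ?case by (simp add: word_span_zero)
next
  case (step c v w)
  then show ?case using words
    by (auto simp: distrib_left scale_mult_right intro!: word_span_add word_span_scale)
qed

lemma linear_zero_on_word_span:
  assumes f: "Vector_Spaces.linear scale (*) f" and w: "w \<in> word_span P"
    and words: "\<And>ws. reduced ws \<Longrightarrow> P (map fst ws) \<Longrightarrow> f (prod_list (map snd ws)) = (0::complex)"
  shows "f w = 0"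
proof -
  interpret f: Vector_Spaces.linear scale "(*)" f by (fact f)
  show ?thesis using w unfolding word_span_def
    by (induction rule: span_induct_alt) (auto simp: f.zero f.add f.scale words)
qed

text \<open>
  A centred letter from the first algebra either extends the word or merges with its first
  letter \<open>y\<close>; in the latter case \<open>c y\<close> splits into a centred letter and a
  scalar.  No letter with index 2 is lost in any of these cases.
\<close>

lemma left_mult_1_depth_span:
  assumes x: "x \<in> A 1" and w: "w \<in> depth_span m"
  shows "x * w \<in> depth_span m"
proof -
  have *: "c * w \<in> depth_span m" if c: "c \<in> A 1" "\<phi> c = 0" for c
    using w unfolding depth_span_def
  proof (rule left_mult_word_span)
    fix ws assume ws: "reduced ws" "m \<le> count_list (map fst ws) 2"
    show "c * prod_list (map snd ws) \<in> word_span (\<lambda>is. m \<le> count_list is 2)"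
    proof (cases "\<exists>y vs. ws = (1, y) # vs")
      case False
      then have "reduced ((1, c) # ws)" using ws(1) c
        by (cases ws) (auto simp: reduced_def centred_def distinct_adj_Cons)
      from word_span_base[OF this, of "\<lambda>is. m \<le> count_list is 2"] ws(2) show ?thesis by simp
    next
      case True
      then obtain y vs where eq: "ws = (1, y) # vs" by auto
      let ?d = "c * y - scale (\<phi> (c * y)) 1"
      have y: "y \<in> A 1" using ws(1) eq by (auto simp: reduced_def centred_def)
      have "?d \<in> A 1" using centre_mem[of 1 "c * y"] mult_mem[of 1 c y] c y by auto
      then have "reduced ((1, ?d) # vs)" using ws(1) eq phi_centre
        by (auto simp: reduced_def centred_def distinct_adj_Cons)
      moreover have "reduced vs" using ws(1) eq
        by (auto simp: reduced_def centred_def distinct_adj_Cons)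
      moreover have "c * prod_list (map snd ws) =
          prod_list (map snd ((1::nat, ?d) # vs)) + scale (\<phi> (c * y)) (prod_list (map snd vs))"
        by (simp add: eq left_diff_distrib scale_mult_left mult.assoc)
      moreover have "m \<le> count_list (map fst ((1::nat, ?d) # vs)) 2" "m \<le> count_list (map fst vs) 2"
        using ws(2) eq by simp_all
      ultimately show ?thesis
        by (simp only:) (intro word_span_add word_span_scale word_span_base)
    qed
  qed
  have "x * w = (x - scale (\<phi> x) 1) * w + scale (\<phi> x) w"
    by (simp add: left_diff_distrib scale_mult_left)
  then show ?thesis using *[of "x - scale (\<phi> x) 1"] centre_mem[of 1 x] x phi_centre w
    by (auto simp: depth_span_def intro: word_span_add word_span_scale)
qed

text \<open>
  Merging with a first letter from the second algebra yields no scalar term, since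
  \<open>\<phi> (y z) = \<phi> y \<phi> z = 0\<close>.  So a letter with index 2 always remains, and it
  stays in front.
\<close>

lemma left_mult_2_word_span:
  assumes y: "y \<in> A 2" "\<phi> y = 0" and w: "w \<in> depth_span m"
  shows "y * w \<in> word_span (\<lambda>is. is \<noteq> [] \<and> hd is = 2 \<and> max 1 m \<le> count_list is 2)"
  using w unfolding depth_span_def
proof (rule left_mult_word_span)
  fix ws assume ws: "reduced ws" "m \<le> count_list (map fst ws) 2"
  show "y * prod_list (map snd ws)
    \<in> word_span (\<lambda>is. is \<noteq> [] \<and> hd is = 2 \<and> max 1 m \<le> count_list is 2)" (is "_ \<in> word_span ?P")
  proof (cases "\<exists>z vs. ws = (2, z) # vs")
    case False
    then have "reduced ((2, y) # ws)" using ws(1) y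
      by (cases ws) (auto simp: reduced_def centred_def distinct_adj_Cons)
    from word_span_base[OF this, of ?P] ws(2) show ?thesis by simp
  next
    case True
    then obtain z vs where eq: "ws = (2, z) # vs" by auto
    have z: "z \<in> A 2" using ws(1) eq by (auto simp: reduced_def centred_def)
    have "reduced ((2, y * z) # vs)" using ws(1) eq y z character mult_mem[of 2 y z]
      by (auto simp: reduced_def centred_def distinct_adj_Cons)
    from word_span_base[OF this, of ?P] ws(2) eq show ?thesis by (simp add: mult.assoc)
  qed
qed

lemma left_mult_2_depth_span:
  assumes "y \<in> A 2" "\<phi> y = 0" "w \<in> depth_span m"
  shows "y * w \<in> depth_span (max 1 m)"
  using left_mult_2_word_span[OF assms] unfolding depth_span_def
  by (rule word_span_mono[THEN subsetD, rotated]) simp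

lemma depth_span_antimono: "m \<le> n \<Longrightarrow> depth_span n \<subseteq> depth_span m"
  unfolding depth_span_def by (rule word_span_mono) simp

lemma one_in_depth_span_0: "1 \<in> depth_span 0"
  using word_span_base[of "[]"] by (simp add: depth_span_def reduced_def centred_def)

text \<open>
  Every reduced word in the expansion of \<open>z w\<close> begins with index 2, so that
  \<open>y\<close> and \<open>c\<close> can be put in front of it without any merging.
\<close>

lemma two_letters_depth_span:
  assumes y: "y \<in> A 2" "\<phi> y = 0" and c: "c \<in> A 1" "\<phi> c = 0" and z: "z \<in> A 2" "\<phi> z = 0"
    and w: "w \<in> depth_span 0"
  shows "y * (c * (z * w)) \<in> depth_span 2"
proof -
  let ?P = "\<lambda>is. is \<noteq> [] \<and> hd is = 2 \<and> max 1 0 \<le> count_list is (2::nat)"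
  have "(y * c) * (z * w) \<in> depth_span 2"
    unfolding depth_span_def
  proof (rule left_mult_word_span[OF left_mult_2_word_span[OF z w]])
    fix ws assume ws: "reduced ws" "?P (map fst ws)"
    have "reduced ((2, y) # (1, c) # ws)" using ws y c
      by (cases ws) (auto simp: reduced_def centred_def distinct_adj_Cons)
    from word_span_base[OF this, of "\<lambda>is. 2 \<le> count_list is 2"] ws(2)
    show "y * c * prod_list (map snd ws) \<in> word_span (\<lambda>is. 2 \<le> count_list is 2)"
      by (simp add: mult.assoc)
  qed
  then show ?thesis by (simp add: mult.assoc)
qed

lemma freeness_reduced:
  assumes "reduced ws" "ws \<noteq> []"
  shows "\<phi> (prod_list (map snd ws)) = 0"
    and "\<phi>' (prod_list (map snd ws)) =
      (\<Sum>k<length ws. \<phi>' (snd (ws ! k)) *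
         \<phi> (prod_list (map snd (take k ws @ drop (Suc k) ws))))"
proof -
  have "snd (ws ! k) \<in> A (fst (ws ! k)) \<and> \<phi> (snd (ws ! k)) = 0" if "k < length ws" for k
    using assms(1) nth_mem[OF that] unfolding reduced_def centred_def by fastforce
  moreover have "fst ` set ws \<subseteq> {1, 2}"
    using assms(1) unfolding reduced_def centred_def by fastforce
  ultimately have "\<phi> (prod_list (map snd ws)) = 0 \<and> \<phi>' (prod_list (map snd ws)) =
      (\<Sum>k<length (map snd ws). \<phi>' (map snd ws ! k) *
        \<phi> (prod_list (take k (map snd ws) @ drop (Suc k) (map snd ws))))"
    using assms free[unfolded infinitesimally_free_def, THEN conjunct2, rule_format,
        of "map snd ws" "map fst ws"]
    by (auto simp: reduced_def)
  then show "\<phi> (prod_list (map snd ws)) = 0"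
    "\<phi>' (prod_list (map snd ws)) =
      (\<Sum>k<length ws. \<phi>' (snd (ws ! k)) *
         \<phi> (prod_list (map snd (take k ws @ drop (Suc k) ws))))"
    by (simp_all add: take_map drop_map)
qed

lemma phi_zero_on_depth_span_1:
  assumes "w \<in> depth_span 1"
  shows "\<phi> w = 0"
  using phi.linear_axioms assms unfolding depth_span_def
  by (rule linear_zero_on_word_span) (auto intro!: freeness_reduced)

text \<open>
  Here consecutive letters may come from the same algebra.  This is needed for the words
  that arise from reduced ones by deleting a letter.
\<close>

lemma centred_in_depth_span:
  assumes "centred ws"
  shows "prod_list (map snd ws) \<in> depth_span (if 2 \<in> set (map fst ws) then 1 else 0)"
  using assms
proof (induction ws)
  case Nil
  then show ?case by (simp add: one_in_depth_span_0)
next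
  case (Cons ix ws)
  obtain i x where ix: "ix = (i, x)" by fastforce
  let ?w = "prod_list (map snd ws)"
  have IH: "?w \<in> depth_span (if 2 \<in> set (map fst ws) then 1 else 0)"
    using Cons by (auto simp: centred_def)
  have x: "i \<in> {1, 2}" "x \<in> A i" "\<phi> x = 0" using Cons.prems ix by (auto simp: centred_def)
  show ?case
  proof (cases "i = 1")
    case True
    then show ?thesis using left_mult_1_depth_span[OF _ IH, of x] x ix by simp
  next
    case False
    then have "i = 2" using x by simp
    moreover have "?w \<in> depth_span 0" using IH depth_span_antimono[of 0] by blast
    ultimately show ?thesis using left_mult_2_depth_span[of x ?w 0] x ix by simp
  qed
qed

text \<open>
  In the Leibniz formula for \<open>\<phi>'\<close>, deleting one letter from a word with two
  letters of index 2 leaves at least one of them, and then \<open>\<phi>\<close> of the rest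
  vanishes.
\<close>

lemma phi'_zero_on_depth_span_2:
  assumes "w \<in> depth_span 2"
  shows "\<phi>' w = 0"
  using phi'.linear_axioms assms unfolding depth_span_def
proof (rule linear_zero_on_word_span)
  fix ws assume ws: "reduced ws" "2 \<le> count_list (map fst ws) 2"
  have "\<phi> (prod_list (map snd (take k ws @ drop (Suc k) ws))) = 0" if k: "k < length ws" for k
  proof -
    let ?vs = "take k ws @ drop (Suc k) ws"
    have "count_list (map fst ws) 2 =
        count_list (map fst (take k ws @ ws ! k # drop (Suc k) ws)) 2"
      using id_take_nth_drop[OF k] by simp
    also have "\<dots> \<le> Suc (count_list (map fst ?vs) 2)" by simp
    finally have "count_list (map fst ?vs) 2 \<noteq> 0" using ws(2) by linarith
    then have "2 \<in> set (map fst ?vs)" by (metis count_notin)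
    moreover have "centred ?vs" using ws(1)
      by (auto simp: reduced_def centred_def dest!: in_set_takeD in_set_dropD)
    ultimately have "prod_list (map snd ?vs) \<in> depth_span 1"
      using centred_in_depth_span[of ?vs] by simp
    then show ?thesis by (rule phi_zero_on_depth_span_1)
  qed
  moreover have "ws \<noteq> []" using ws(2) by auto
  ultimately show "\<phi>' (prod_list (map snd ws)) = 0"
    using freeness_reduced(2)[OF ws(1)] by simp
qed

text \<open>
  For the centred part of \<open>x\<close> the product contains two letters of index 2 separated
  by a centred letter, hence contributes nothing; only the scalar part is left.
\<close>

lemma phi'_reduce:
  assumes e: "e \<in> A 1" and x: "x \<in> A 1" and b: "b \<in> A 2" "\<phi> b = 0" and k: "k \<ge> 1"
    and w: "w \<in> depth_span 0"
  shows "\<phi>' (e * (b ^ k * (x * (b * w)))) = \<phi> x * \<phi>' (e * (b ^ Suc k * w))"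
proof -
  let ?c = "x - scale (\<phi> x) 1"
  have "?c \<in> A 1" using centre_mem[of 1 x] x by simp
  then have "b ^ k * (?c * (b * w)) \<in> depth_span 2"
    using two_letters_depth_span[of "b ^ k" ?c b w] b k w power_mem[of 2 b k] phi_power[of b k]
      phi_centre by simp
  then have "\<phi>' (e * (b ^ k * (?c * (b * w)))) = 0"
    using left_mult_1_depth_span[OF e] phi'_zero_on_depth_span_2 by blast
  moreover have "e * (b ^ k * (x * (b * w))) =
      e * (b ^ k * (?c * (b * w))) + scale (\<phi> x) (e * (b ^ Suc k * w))"
    by (simp add: left_diff_distrib right_diff_distrib scale_mult_left scale_mult_right
        mult.assoc power_Suc2 del: power_Suc)
  ultimately show ?thesis by (simp only: phi'.add phi'.scale add_0)
qed

section \<open>Moments of the commutator\<close>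

text \<open>
  The boundary terms that remain when all factors \<open>p\<close> have been removed.
\<close>

lemma phi'_sandwich:
  assumes a: "a \<in> A 1" "\<phi> a = 0" and b: "b \<in> A 2" "\<phi> b = 0" and k: "k \<ge> 1"
  shows "\<phi>' (a * b ^ k) = 0" "\<phi>' (b ^ k * a) = 0"
    "\<phi>' (a * (b ^ k * a)) = \<phi> (a * a) * \<phi>' (b ^ k)"
proof -
  have bk: "b ^ k \<in> A 2" "\<phi> (b ^ k) = 0"
    using b k power_mem[of 2 b k] phi_power[of b k] by auto
  have "reduced [(1, a), (2, b ^ k)]" "reduced [(2, b ^ k), (1, a)]"
    "reduced [(1, a), (2, b ^ k), (1, a)]"
    using a bk by (auto simp: reduced_def centred_def)
  note * = this[THEN freeness_reduced(2)] this[THEN freeness_reduced(1)]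
  show "\<phi>' (a * b ^ k) = 0" "\<phi>' (b ^ k * a) = 0"
    "\<phi>' (a * (b ^ k * a)) = \<phi> (a * a) * \<phi>' (b ^ k)"
    using * a bk by (simp_all add: lessThan_Suc numeral_2_eq_2 numeral_3_eq_3)
qed

context
  fixes a b p :: 'a
  assumes a: "a \<in> A 1" "\<phi> a = 0" and b: "b \<in> A 2" "\<phi> b = 0"
    and p: "p = a * b - b * a"
begin

lemma commutator_mult_depth_span:
  assumes "w \<in> depth_span 0"
  shows "p * w \<in> depth_span 1"
proof -
  have "a * (b * w) \<in> depth_span 1"
    using left_mult_1_depth_span[OF a(1)] left_mult_2_depth_span[OF b assms] by simp
  moreover have "b * (a * w) \<in> depth_span 1"
    using left_mult_1_depth_span[OF a(1) assms] left_mult_2_depth_span[OF b] by fastforce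
  ultimately show ?thesis
    by (simp add: p left_diff_distrib mult.assoc depth_span_def word_span_diff)
qed

lemma commutator_power_depth_span: "p ^ n \<in> depth_span 0"
proof (induction n)
  case (Suc n)
  then show ?case using commutator_mult_depth_span depth_span_antimono[of 0 1] by auto
qed (simp add: one_in_depth_span_0)

lemma phi_commutator_power: "n \<ge> 1 \<Longrightarrow> \<phi> (p ^ n) = 0"
  using commutator_mult_depth_span[OF commutator_power_depth_span[of "n - 1"]]
  by (cases n) (auto intro: phi_zero_on_depth_span_1)

text \<open>
  Both identities expand the first \<open>p = ab - ba\<close> and apply \<open>phi'_reduce\<close>.
  After \<open>b\<^sup>k\<close> only the term \<open>ba\<close> survives, after \<open>b\<^sup>k a\<close> only the term
  \<open>ab\<close>.
\<close>

lemma phi'_commutator_step: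
  assumes e: "e \<in> A 1" and k: "k \<ge> 1" and w: "w \<in> depth_span 0"
  shows "\<phi>' (e * (b ^ k * (p * w))) = - \<phi>' (e * (b ^ Suc k * (a * w)))"
    and "\<phi>' (e * (b ^ k * (a * (p * w)))) = \<phi> (a * a) * \<phi>' (e * (b ^ Suc k * w))"
proof -
  have aw: "a * w \<in> depth_span 0" using left_mult_1_depth_span[OF a(1) w] .
  have "e * (b ^ k * (p * w)) = e * (b ^ k * (a * (b * w))) - e * (b ^ Suc k * (a * w))"
    by (simp add: p left_diff_distrib right_diff_distrib mult.assoc power_Suc2 del: power_Suc)
  then show "\<phi>' (e * (b ^ k * (p * w))) = - \<phi>' (e * (b ^ Suc k * (a * w)))"
    using phi'_reduce[OF e a(1) b k w] a(2) by (simp add: phi'.diff del: power_Suc)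
  have "e * (b ^ k * (a * (p * w))) =
      e * (b ^ k * ((a * a) * (b * w))) - e * (b ^ k * (a * (b * (a * w))))"
    by (simp add: p left_diff_distrib right_diff_distrib mult.assoc)
  then show "\<phi>' (e * (b ^ k * (a * (p * w)))) = \<phi> (a * a) * \<phi>' (e * (b ^ Suc k * w))"
    using phi'_reduce[OF e mult_mem[of 1 a a] b k w] phi'_reduce[OF e a(1) b k aw] a
    by (simp add: phi'.diff del: power_Suc)
qed

text \<open>
  One application of each rule of \<open>phi'_commutator_step\<close> removes two factors
  \<open>p\<close>, adds 2 to the exponent of \<open>b\<close>, and multiplies by
  \<open>- \<phi> (a a)\<close>.
\<close>

lemma phi'_commutator_even_power:
  assumes e: "e \<in> A 1" and k: "k \<ge> 1"
  shows "\<phi>' (e * (b ^ k * p ^ (2 * m))) = (- \<phi> (a * a)) ^ m * \<phi>' (e * b ^ (k + 2 * m))"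
    and "\<phi>' (e * (b ^ k * (a * p ^ (2 * m)))) =
      (- \<phi> (a * a)) ^ m * \<phi>' (e * (b ^ (k + 2 * m) * a))"
proof -
  have "\<phi>' (e * (b ^ k * p ^ (2 * m))) = (- \<phi> (a * a)) ^ m * \<phi>' (e * b ^ (k + 2 * m)) \<and>
    \<phi>' (e * (b ^ k * (a * p ^ (2 * m)))) =
      (- \<phi> (a * a)) ^ m * \<phi>' (e * (b ^ (k + 2 * m) * a))"
    using k
  proof (induction m arbitrary: k)
    case (Suc m)
    have eq: "p ^ (2 * Suc m) = p * (p * p ^ (2 * m))" "k + 2 * Suc m = Suc (Suc k) + 2 * m"
      by simp_all
    have w: "p ^ (2 * m) \<in> depth_span 0" "p * p ^ (2 * m) \<in> depth_span 0"
      using commutator_power_depth_span[of "2 * m"] commutator_power_depth_span[of "Suc (2 * m)"]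
      by simp_all
    have k: "k \<ge> 1" "Suc k \<ge> 1" "Suc (Suc k) \<ge> 1" using Suc.prems by auto
    show ?case unfolding eq
      using Suc.IH[OF k(3)] phi'_commutator_step[OF e k(1) w(2)] phi'_commutator_step[OF e k(2) w(1)]
      by (simp del: power_Suc add: power_Suc[of "- \<phi> (a * a)"])
  qed simp
  then show "\<phi>' (e * (b ^ k * p ^ (2 * m))) = (- \<phi> (a * a)) ^ m * \<phi>' (e * b ^ (k + 2 * m))"
    "\<phi>' (e * (b ^ k * (a * p ^ (2 * m)))) =
      (- \<phi> (a * a)) ^ m * \<phi>' (e * (b ^ (k + 2 * m) * a))" by auto
qed

lemma phi'_commutator_power:
  "\<phi>' (p ^ (2 * m + 1)) = 0"
  "\<phi>' (p ^ (2 * m + 2)) = 2 * (- \<phi> (a * a)) ^ (m + 1) * \<phi>' (b ^ (2 * m + 2))"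
proof -
  have split: "\<phi>' (p ^ Suc n) = \<phi>' (a * (b ^ 1 * p ^ n)) - \<phi>' (1 * (b ^ 1 * (a * p ^ n)))" for n
    by (simp add: p left_diff_distrib mult.assoc phi'.diff)
  have one: "1 \<in> A 1" using one_mem[of 1] by simp
  show "\<phi>' (p ^ (2 * m + 1)) = 0"
    using split[of "2 * m"] phi'_commutator_even_power(1)[OF a(1), of 1 m]
      phi'_commutator_even_power(2)[OF one, of 1 m] phi'_sandwich(1,2)[OF a b, of "1 + 2 * m"]
    by simp
  have w: "p ^ (2 * m) \<in> depth_span 0" by (rule commutator_power_depth_span)
  have "\<phi>' (a * (b ^ 1 * p ^ Suc (2 * m))) =
      - ((- \<phi> (a * a)) ^ m * (\<phi> (a * a) * \<phi>' (b ^ (2 * m + 2))))"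
    using phi'_commutator_step(1)[OF a(1) _ w, of 1]
      phi'_commutator_even_power(2)[OF a(1), of 2 m] phi'_sandwich(3)[OF a b, of "2 + 2 * m"]
    by (simp add: numeral_2_eq_2)
  moreover have "\<phi>' (1 * (b ^ 1 * (a * p ^ Suc (2 * m)))) =
      \<phi> (a * a) * ((- \<phi> (a * a)) ^ m * \<phi>' (b ^ (2 * m + 2)))"
    using phi'_commutator_step(2)[OF one _ w, of 1] phi'_commutator_even_power(1)[OF one, of 2 m]
    by (simp add: numeral_2_eq_2)
  ultimately show "\<phi>' (p ^ (2 * m + 2)) = 2 * (- \<phi> (a * a)) ^ (m + 1) * \<phi>' (b ^ (2 * m + 2))"
    using split[of "2 * m + 1"] by simp
qed

end

end

section \<open>The commutator with an infinitesimal operator\<close>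

theorem theorem3p9:
  fixes scale :: "complex \<Rightarrow> 'a::ring_1 \<Rightarrow> 'a"
    and \<phi> \<phi>' :: "'a \<Rightarrow> complex"
    and x\<^sub>1 x\<^sub>2 q :: 'a
    and \<omega> :: complex
  assumes "infinitesimal_probability_space scale \<phi> \<phi>'"
    and "infinitesimally_free_pair scale \<phi> \<phi>' x\<^sub>1 x\<^sub>2"
    and "infinitesimal_operator \<phi> x\<^sub>2"
    and "q = scale \<i> (x\<^sub>1 * x\<^sub>2 - x\<^sub>2 * x\<^sub>1)"
    and "\<omega>\<^sup>2 = cumulant \<phi> 2 x\<^sub>1"
  shows "(\<forall>n\<ge>1.
        inf_cumulant \<phi> \<phi>' n q = inf_moment \<phi>' n q \<and>
        inf_moment \<phi>' n q =
          inf_cumulant \<phi> \<phi>' n (scale \<omega> x\<^sub>2) + inf_cumulant \<phi> \<phi>' n (scale (- \<omega>) x\<^sub>2) \<and>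
        inf_cumulant \<phi> \<phi>' n (scale \<omega> x\<^sub>2) + inf_cumulant \<phi> \<phi>' n (scale (- \<omega>) x\<^sub>2) =
          (if even n then 2 * inf_cumulant \<phi> \<phi>' n (scale \<omega> x\<^sub>2) else 0)) \<and>
      inf_Cauchy_transform \<phi>' q =
        inf_Cauchy_transform \<phi>' (scale \<omega> x\<^sub>2) + inf_Cauchy_transform \<phi>' (scale (- \<omega>) x\<^sub>2) \<and>
      inf_r_transform \<phi> \<phi>' q =
        inf_r_transform \<phi> \<phi>' (scale \<omega> x\<^sub>2) + inf_r_transform \<phi> \<phi>' (scale (- \<omega>) x\<^sub>2)"
proof -
  interpret infinitesimal_probability_space scale \<phi> \<phi>' by (fact assms(1))
  define A where "A = (\<lambda>i::nat. unital_subalgebra scale hull {if i = 1 then x\<^sub>1 else x\<^sub>2})"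
  interpret free_from_character scale \<phi> \<phi>' A
  proof
    show "infinitesimally_free scale \<phi> \<phi>' {1, 2} A"
      using assms(2) by (simp add: infinitesimally_free_pair_def A_def)
    show "\<phi> (y * z) = \<phi> y * \<phi> z" if "y \<in> A 2" "z \<in> A 2" for y z
      using multiplicative_on_infinitesimal_operator[OF assms(3)] that by (simp add: A_def)
  qed
  define a where "a = x\<^sub>1 - scale (\<phi> x\<^sub>1) 1"
  have "x\<^sub>1 \<in> A 1" and b: "x\<^sub>2 \<in> A 2" by (simp_all add: A_def hull_inc)
  then have a: "a \<in> A 1" "\<phi> a = 0"
    using centre_mem[of 1 x\<^sub>1] phi_centre by (simp_all add: a_def)
  have \<phi>b: "\<phi> x\<^sub>2 = 0" using assms(3) by (auto simp: infinitesimal_operator_def dest: spec[of _ 1])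
  define p where "p = a * x\<^sub>2 - x\<^sub>2 * a"
  have q: "q = scale \<i> p"
    by (simp add: assms(4) p_def a_def left_diff_distrib right_diff_distrib
        scale_mult_left scale_mult_right)
  have "\<phi> (a * a) = \<phi> (x\<^sub>1 * x\<^sub>1) - (\<phi> x\<^sub>1)\<^sup>2"
    by (simp add: a_def left_diff_distrib right_diff_distrib scale_mult_left scale_mult_right
        phi.diff phi.scale phi_one power2_eq_square)
  then have \<omega>: "\<phi> (a * a) = \<omega>\<^sup>2" using assms(5) by (simp add: cumulant_2)
  have q_inf: "infinitesimal_operator \<phi> q"
    using phi_commutator_power[OF a b \<phi>b p_def]
    by (auto simp: infinitesimal_operator_def q scale_power phi.scale)
  have scaled_inf: "infinitesimal_operator \<phi> (scale c x\<^sub>2)" for c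
    using assms(3) by (auto simp: infinitesimal_operator_def scale_power phi.scale)
  \<comment> \<open>Without this, \<open>scale (- \<omega>) x\<^sub>2\<close> is rewritten to
    \<open>- scale \<omega> x\<^sub>2\<close>, which is not of the form that the next facts treat.\<close>
  note scale_minus_left [simp del]
  have scaled_moment: "inf_moment \<phi>' n (scale c x\<^sub>2) = c ^ n * inf_moment \<phi>' n x\<^sub>2" for n c
    by (simp add: inf_moment_def scale_power phi'.scale)
  have moment: "inf_moment \<phi>' n q = inf_moment \<phi>' n (scale \<omega> x\<^sub>2) + inf_moment \<phi>' n (scale (- \<omega>) x\<^sub>2)"
    if "n \<ge> 1" for n
  proof (cases "even n")
    case True
    with that have "n = 2 * (n div 2 - 1) + 2" by (auto elim!: evenE)
    then obtain m where m: "n = 2 * m + 2" by blast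
    \<comment> \<open>The powers of \<open>\<i>\<close> cancel the signs from the moments of the
      commutator.\<close>
    have "\<i> ^ n = (- 1) ^ (m + 1)" unfolding m
      by (simp add: power_mult power2_eq_square)
    then have "\<i> ^ n * (- \<omega>\<^sup>2) ^ (m + 1) = ((- 1) * (- \<omega>\<^sup>2)) ^ (m + 1)"
      by (simp only: power_mult_distrib)
    also have "\<dots> = \<omega> ^ n"
      using power_mult[of \<omega> 2 "m + 1"] by (simp add: m)
    finally have powers: "\<i> ^ n * (- \<omega>\<^sup>2) ^ (m + 1) = \<omega> ^ n" .
    have "\<phi>' (p ^ n) = 2 * (- \<omega>\<^sup>2) ^ (m + 1) * \<phi>' (x\<^sub>2 ^ n)"
      unfolding m using phi'_commutator_power(2)[OF a b \<phi>b p_def, of m] \<omega> by simp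
    moreover have "inf_moment \<phi>' n q = \<i> ^ n * \<phi>' (p ^ n)"
      by (simp add: inf_moment_def q scale_power phi'.scale)
    ultimately have "inf_moment \<phi>' n q =
        2 * ((\<i> ^ n * (- \<omega>\<^sup>2) ^ (m + 1)) * \<phi>' (x\<^sub>2 ^ n))"
      by (simp only: mult.assoc mult.left_commute)
    then have "inf_moment \<phi>' n q = 2 * (\<omega> ^ n * \<phi>' (x\<^sub>2 ^ n))"
      by (simp only: powers mult.assoc)
    then have "inf_moment \<phi>' n q = 2 * (\<omega> ^ n * inf_moment \<phi>' n x\<^sub>2)"
      by (simp only: inf_moment_def)
    then show ?thesis using True by (simp add: scaled_moment)
  next
    case False
    then have "\<phi>' (p ^ n) = 0"
      using phi'_commutator_power(1)[OF a b \<phi>b p_def] by (auto elim!: oddE)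
    then have "inf_moment \<phi>' n q = 0" by (simp add: inf_moment_def q scale_power phi'.scale)
    with False show ?thesis by (simp add: scaled_moment)
  qed
  note cumulant_moment = inf_cumulant_infinitesimal_operator[OF q_inf]
    inf_cumulant_infinitesimal_operator[OF scaled_inf]
  show ?thesis
  proof (intro conjI allI impI)
    fix n :: nat assume n: "n \<ge> 1"
    show "inf_cumulant \<phi> \<phi>' n q = inf_moment \<phi>' n q"
      using n by (rule cumulant_moment)
    show "inf_moment \<phi>' n q =
        inf_cumulant \<phi> \<phi>' n (scale \<omega> x\<^sub>2) + inf_cumulant \<phi> \<phi>' n (scale (- \<omega>) x\<^sub>2)"
      using n by (simp add: cumulant_moment moment)
    show "inf_cumulant \<phi> \<phi>' n (scale \<omega> x\<^sub>2) + inf_cumulant \<phi> \<phi>' n (scale (- \<omega>) x\<^sub>2) =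
        (if even n then 2 * inf_cumulant \<phi> \<phi>' n (scale \<omega> x\<^sub>2) else 0)"
      using n by (simp add: cumulant_moment scaled_moment)
  next
    show "inf_Cauchy_transform \<phi>' q =
        inf_Cauchy_transform \<phi>' (scale \<omega> x\<^sub>2) + inf_Cauchy_transform \<phi>' (scale (- \<omega>) x\<^sub>2)"
      by (rule fps_ext) (auto simp: inf_Cauchy_transform_def moment)
    show "inf_r_transform \<phi> \<phi>' q =
        inf_r_transform \<phi> \<phi>' (scale \<omega> x\<^sub>2) + inf_r_transform \<phi> \<phi>' (scale (- \<omega>) x\<^sub>2)"
      by (rule fps_ext) (simp add: inf_r_transform_def cumulant_moment moment)
  qed
qed

end
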